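(* Let $\lambda,a_1,a_2,b_1,b_2$ be real numbers with $a_1^2+b_1^2\neq0$. Define $T_{n,k}$ by $T_{0,0}=1$, $T_{n,k}=0$ unless $0\le k\le n$, and for $n\ge1$ $$T_{n,k}=(b_1k+b_2)T_{n-1,k-1}+[(2\lambda b_1+a_1)k+a_2+\lambda(b_1+b_2)]T_{n-1,k}+\lambda(a_1+\lambda b_1)(k+1)T_{n-1,k+1},$$ and let $T_n(q)=\sum_{k\ge0}T_{n,k}q^k$. Then: (i) as formal power series in $t$, $$\sum_{n\geq0}T_n(q)\frac{t^n}{n!}=e^{a_2t}\left[1+\frac{b_1(q+\lambda)(1-e^{a_1t})}{a_1}\right]^{-(1+\frac{b_2}{b_1})}$$ when $a_1b_1\neq 0$; while $\sum_{n\geq0}T_n(q)\frac{t^n}{n!}=e^{a_2t}\left[1-b_1(q+\lambda)t\right]^{-(1+\frac{b_2}{b_1})}$ when $a_1=0,b_1\neq0$, and $\sum_{n\geq0}T_n(q)\frac{t^n}{n!}=\exp\!\left(a_2t+\frac{b_2(q+\lambda)(e^{a_1t}-1)}{a_1}\right)$ when $a_1\neq0,b_1=0$. (ii) For $n,k\ge0$, $$T_{n,k}=\sum_{i\geq k}\frac{\prod_{j=1}^i(b_2+b_1j)}{a_1^i}\binom{i}{k}\lambda^{i-k}\frac{1}{i!}\sum_{j=0}^i\binom{i}{j}(-1)^{i-j}(a_2+a_1j)^n\quad\text{if } a_1\neq0,$$ $$T_{n,k}=\sum_{i\geq k}\prod_{j=1}^i(b_2+b_1j)\binom{n}{i}\binom{i}{k}\lambda^{i-k}a_2^{n-i}\quad\text{if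 } a_1=0.$$
   Context: Powers of the form $(1+u)^{\alpha}$ with $u$ a formal power series without constant term are defined by the binomial series $\sum_{i\ge0}\binom{\alpha}{i}u^i$. Empty products equal $1$ and $0^0=1$. *)

theory Defs
  imports
    "HOL-Analysis.Infinite_Sum"
    "HOL-Computational_Algebra.Computational_Algebra"
begin

(* The entry at column -1 is zero, which accounts for the case k = 0 of the first summand. *)
fun tri :: "real \<Rightarrow> real \<Rightarrow> real \<Rightarrow> real \<Rightarrow> real \<Rightarrow> nat \<Rightarrow> nat \<Rightarrow> real" where
  "tri lam a1 a2 b1 b2 0 k = (if k = 0 then 1 else 0)"
| "tri lam a1 a2 b1 b2 (Suc n) k =
     (if k \<le> Suc n then
        (if k = 0 then 0 else (b1 * real k + b2) * tri lam a1 a2 b1 b2 n (k - 1))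
        + ((2 * lam * b1 + a1) * real k + a2 + lam * (b1 + b2)) * tri lam a1 a2 b1 b2 n k
        + lam * (a1 + lam * b1) * (real k + 1) * tri lam a1 a2 b1 b2 n (k + 1)
      else 0)"

definition tri_poly :: "real \<Rightarrow> real \<Rightarrow> real \<Rightarrow> real \<Rightarrow> real \<Rightarrow> nat \<Rightarrow> real poly" where
  "tri_poly lam a1 a2 b1 b2 n = (\<Sum>k\<le>n. monom (tri lam a1 a2 b1 b2 n k) k)"

(* Generating functions live in R[q][[t]], represented as real poly fps: the polynomial
   variable is q and fps_X is t. *)
definition tri_egf :: "real \<Rightarrow> real \<Rightarrow> real \<Rightarrow> real \<Rightarrow> real \<Rightarrow> real poly fps" where
  "tri_egf lam a1 a2 b1 b2 = Abs_fps (\<lambda>n. smult (1 / fact n) (tri_poly lam a1 a2 b1 b2 n))"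

(* The library's fps_exp and fps_binomial need coefficients in a field, which real poly is not;
   they are taken over the reals and carried along the embedding of R[[t]] into R[q][[t]]. *)
definition fps_lift :: "real fps \<Rightarrow> real poly fps" where
  "fps_lift f = Abs_fps (\<lambda>n. [:fps_nth f n:])"

(* The two compositions below are meaningful only for an inner series without constant term:
   g must have zero constant coefficient in the first, constant coefficient 1 in the second,
   where (1 + u) to the power x is the binomial series with u = g - 1. *)
definition fps_exp_of :: "real poly fps \<Rightarrow> real poly fps" where
  "fps_exp_of g = fps_compose (fps_lift (fps_exp 1)) g"

definition fps_rpow :: "real poly fps \<Rightarrow> real \<Rightarrow> real poly fps" where
  "fps_rpow g x = fps_compose (fps_lift (fps_binomial x)) (g - 1)"

end

theory Submission
  imports Defs
begin

text \<open>
  Let \<open>u\<close> be the power series in \<open>t\<close> with \<open>u(0) = 0\<close> and \<open>u' = 1 + a1 u\<close>, so \<open>u = (exp (a1 t) - 1) / a1\<close>,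
  or \<open>u = t\<close> if \<open>a1 = 0\<close>. The numbers \<open>w n i = n! [t^n] (exp (a2 t) u^i / i!)\<close> satisfy
  \<open>w (n + 1) i = (a2 + a1 i) w n i + w n (i - 1)\<close>, and from this the recurrence of the triangle gives
  \<open>T_n(q) = (\<Sum>i. (\<Prod>j=1..i. b2 + b1 j) w n i (q + lam)^i)\<close>. Comparing coefficients of powers of \<open>q\<close>
  yields (ii), and summing over \<open>n\<close> yields \<open>exp (a2 t)\<close> times a binomial or exponential series in
  \<open>(q + lam) u\<close>, which is (i).
\<close>

section \<open>The embedding of R[[t]] into R[q][[t]] and coefficients of compositions\<close>

lemma fps_lift_nth [simp]: "fps_nth (fps_lift f) n = [:fps_nth f n:]"
  by (simp add: fps_lift_def)

lemma sum_const_poly: "(\<Sum>i\<in>A. [:f i:]) = [:\<Sum>i\<in>A. f i:]"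
  by (induction A rule: infinite_finite_induct) auto

lemma smult_sum_right: "smult c (\<Sum>i\<in>A. f i) = (\<Sum>i\<in>A. smult c (f i))"
  by (induction A rule: infinite_finite_induct) (auto simp: smult_add_right)

lemma coeff_monic_linear_power:
  fixes c :: "'a :: comm_semiring_1"
  shows "coeff ([:c, 1:] ^ n) k = of_nat (n choose k) * c ^ (n - k)"
proof (cases "k \<le> n")
  case True
  then show ?thesis by (simp add: coeff_linear_poly_power)
next
  case False
  then show ?thesis by (simp add: coeff_eq_0 degree_linear_power binomial_eq_0)
qed

lemma fps_lift_mult: "fps_lift (f * g) = fps_lift f * fps_lift g"
  by (rule fps_ext) (simp add: fps_mult_nth sum_const_poly ac_simps)

lemma fps_lift_diff: "fps_lift (f - g) = fps_lift f - fps_lift g"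
  by (rule fps_ext) simp

lemma fps_lift_1: "fps_lift 1 = 1"
  by (rule fps_ext) (simp add: one_pCons)

lemma fps_lift_const: "fps_lift (fps_const c) = fps_const [:c:]"
  by (rule fps_ext) simp

lemma fps_lift_X: "fps_lift fps_X = fps_X"
  by (rule fps_ext) (simp add: fps_X_def one_pCons)

lemma fps_lift_power: "fps_lift (f ^ n) = fps_lift f ^ n"
  by (induction n) (simp_all add: fps_lift_1 fps_lift_mult)

lemma fps_lift_deriv: "fps_deriv (fps_lift f) = fps_lift (fps_deriv f)"
  by (rule fps_ext) (simp add: of_nat_poly)

text \<open>Since t divides \<open>h\<close>, t^i divides \<open>h ^ i\<close>. This is what cuts
  the sums over powers of a series off at \<open>i = n\<close>.\<close>

lemma fps_mult_power_nth_eq_0: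
  fixes f h :: "'a :: comm_ring_1 fps"
  assumes "fps_nth h 0 = 0" "n < i"
  shows "fps_nth (f * h ^ i) n = 0"
proof -
  have "fps_nth (h ^ i) (n - k) = 0" for k
    using assms startsby_zero_power_prefix[of h i] by auto
  then show ?thesis
    by (simp add: fps_mult_nth)
qed

lemma fps_mult_compose_nth:
  fixes f e g :: "'a :: comm_ring_1 fps"
  assumes "fps_nth g 0 = 0"
  shows "fps_nth (e * fps_compose f g) n = (\<Sum>i\<le>n. fps_nth f i * fps_nth (e * g ^ i) n)"
proof -
  \<comment> \<open>The added terms with \<open>i > n - m\<close> vanish; a range of
    \<open>i\<close> that does not depend on \<open>m\<close> allows the two sums to be
    swapped.\<close>
  have ext: "(\<Sum>i=0..n-m. fps_nth f i * fps_nth (g ^ i) (n - m)) =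
      (\<Sum>i\<le>n. fps_nth f i * fps_nth (g ^ i) (n - m))" for m
    using fps_mult_power_nth_eq_0[of g _ _ 1] assms
    by (intro sum.mono_neutral_left) auto
  have "fps_nth (e * fps_compose f g) n =
      (\<Sum>m=0..n. \<Sum>i\<le>n. fps_nth e m * (fps_nth f i * fps_nth (g ^ i) (n - m)))"
    by (simp add: fps_mult_nth fps_compose_nth ext sum_distrib_left)
  also have "\<dots> = (\<Sum>i\<le>n. fps_nth f i * fps_nth (e * g ^ i) n)"
    by (subst sum.swap) (simp add: fps_mult_nth sum_distrib_left ac_simps)
  finally show ?thesis .
qed

text \<open>As \<open>p\<close> is constant in t, its powers leave the powers of the inner series,
  and the rest has real coefficients. So the dependence on q sits in \<open>p ^ i\<close>
  alone.\<close>

lemma fps_lift_mult_compose_nth: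
  assumes "fps_nth u 0 = 0"
  shows "fps_nth (fps_lift e * fps_compose (fps_lift f) (fps_const p * fps_lift u)) n =
    (\<Sum>i\<le>n. smult (fps_nth f i * fps_nth (e * u ^ i) n) (p ^ i))"
proof -
  have "fps_lift e * (fps_const p * fps_lift u) ^ i = fps_const (p ^ i) * fps_lift (e * u ^ i)" for i
    by (simp add: power_mult_distrib fps_lift_mult fps_lift_power fps_const_power ac_simps)
  then show ?thesis
    using assms by (simp add: fps_mult_compose_nth mult.commute)
qed

section \<open>Linear differential equations and the exponential of a series\<close>

lemma fps_linear_ode_unique:
  fixes y z g :: "'a :: {idom, ring_char_0} fps"
  assumes "fps_deriv y = y * g" "fps_deriv z = z * g" "fps_nth y 0 = fps_nth z 0"
  shows "y = z"
proof (rule fps_ext)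
  fix n
  show "fps_nth y n = fps_nth z n"
  proof (induction n rule: less_induct)
    case (less n)
    show ?case
    proof (cases n)
      case 0
      then show ?thesis using assms by simp
    next
      case (Suc m)
      have "fps_nth (y * g) m = fps_nth (z * g) m"
        using less Suc by (simp add: fps_mult_nth)
      then have "fps_nth (fps_deriv y) m = fps_nth (fps_deriv z) m"
        using assms by simp
      then have "of_nat (Suc m) * fps_nth y (Suc m) = of_nat (Suc m) * fps_nth z (Suc m)"
        by simp
      then show ?thesis
        using Suc by (simp del: of_nat_Suc)
    qed
  qed
qed

lemma fps_exp_of_deriv:
  assumes "fps_nth g 0 = 0"
  shows "fps_deriv (fps_exp_of g) = fps_exp_of g * fps_deriv g"
  using assms by (simp add: fps_exp_of_def fps_compose_deriv fps_lift_deriv)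

lemma fps_exp_of_nth_0 [simp]: "fps_nth (fps_exp_of g) 0 = 1"
  by (simp add: fps_exp_of_def one_pCons)

text \<open>Both sides solve y' = y (a + g') with y(0) = 1. The lemma serves to absorb the factor
  exp(a2 t) into the exponent when \<open>b1 = 0\<close>.\<close>

lemma fps_exp_of_add_linear:
  assumes "fps_nth g 0 = 0"
  shows "fps_exp_of (fps_const [:a:] * fps_X + g) = fps_lift (fps_exp a) * fps_exp_of g"
proof (rule fps_linear_ode_unique[where g = "fps_const [:a:] + fps_deriv g"])
  show "fps_deriv (fps_exp_of (fps_const [:a:] * fps_X + g)) =
      fps_exp_of (fps_const [:a:] * fps_X + g) * (fps_const [:a:] + fps_deriv g)"
    using assms by (simp add: fps_exp_of_deriv)
  show "fps_deriv (fps_lift (fps_exp a) * fps_exp_of g) =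
      fps_lift (fps_exp a) * fps_exp_of g * (fps_const [:a:] + fps_deriv g)"
    using assms
    by (simp add: fps_exp_of_deriv fps_lift_deriv fps_lift_mult fps_lift_const algebra_simps)
qed (simp add: fps_mult_nth one_pCons)

section \<open>The triangle in the basis of powers of q + lam\<close>

text \<open>Read as an operator on polynomials in q, the recurrence sends Q^i, with Q = q + lam, to
  (a2 + a1 i) Q^i + (b2 + b1 (i + 1)) Q^(i+1). The identity compares coefficients of q^k;
  \<open>g i k\<close> is that coefficient of Q^i.\<close>

lemma binomial_shift_identity:
  fixes lam a1 a2 b1 b2 :: real
  shows "(a2 + a1 * real i) * (real (i choose k) * lam ^ (i - k))
      + (b2 + b1 * real (Suc i)) * (real (Suc i choose k) * lam ^ (Suc i - k)) =
    (if k = 0 then 0 else (b1 * real k + b2) * (real (i choose (k - 1)) * lam ^ (i - (k - 1))))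
      + ((2 * lam * b1 + a1) * real k + a2 + lam * (b1 + b2)) * (real (i choose k) * lam ^ (i - k))
      + lam * (a1 + lam * b1) * (real k + 1) * (real (i choose (k + 1)) * lam ^ (i - (k + 1)))"
proof -
  define g where "g = (\<lambda>i k. real (i choose k) * lam ^ (i - k))"
  define h where "h = (if k = 0 then 0 else g i (k - 1))"
  have choose: "(real j + 1) * real (i choose Suc j) = (real i - real j) * real (i choose j)" for j
  proof (cases "j \<le> i")
    case True
    have "Suc j * (i choose Suc j) = (i - j) * (i choose j)"
      by (simp only: binomial_absorption binomial_absorb_comp)
    then show ?thesis
      using True by (metis of_nat_Suc of_nat_diff of_nat_mult add.commute)
  qed (simp add: binomial_eq_0)
  \<comment> \<open>Coefficient of q^j in Q (Q^i)' = i Q^i, the derivative taken in q.\<close>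
  have up: "lam * (real j + 1) * g i (Suc j) = (real i - real j) * g i j" for j
  proof (cases "j < i")
    case True
    then have "lam ^ (i - j) = lam * lam ^ (i - Suc j)"
      by (metis Suc_diff_Suc power_Suc)
    then show ?thesis
      using choose[of j] by (simp add: g_def)
  next
    case False
    then show ?thesis by (cases "j = i") (auto simp: g_def binomial_eq_0)
  qed
  \<comment> \<open>Coefficient of q^k in Q^(i+1) = q Q^i + lam Q^i; \<open>h\<close> is the
    contribution of q Q^i.\<close>
  have step: "g (Suc i) k = h + lam * g i k"
  proof (cases "k \<le> i")
    case True
    then have "lam ^ (Suc i - k) = lam * lam ^ (i - k)"
      by (simp add: Suc_diff_le)
    then show ?thesis
      by (cases k) (auto simp: g_def h_def algebra_simps)
  next
    case False
    then show ?thesis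
      by (cases "k = Suc i") (auto simp: g_def h_def binomial_eq_0)
  qed
  have down: "(real i + 1 - real k) * h = real k * lam * g i k"
    using up[of "k - 1"] by (cases k) (auto simp: h_def algebra_simps)
  \<comment> \<open>Once \<open>up\<close> and \<open>step\<close> are substituted, the two sides
    differ by \<open>b1\<close> times \<open>down\<close>.\<close>
  have "(a2 + a1 * real i) * g i k + (b2 + b1 * real (Suc i)) * g (Suc i) k =
    (b1 * real k + b2) * h + ((2 * lam * b1 + a1) * real k + a2 + lam * (b1 + b2)) * g i k
      + (a1 + lam * b1) * (lam * (real k + 1) * g i (Suc k))"
    unfolding up step using down by simp algebra
  then show ?thesis
    by (simp add: g_def h_def algebra_simps)
qed

text \<open>For a = 0 and u = exp(t) - 1 these are the Stirling numbers of the second kind. The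
  factor 1/i! makes the second term of their recurrence have coefficient 1.\<close>

definition exp_power_coeff :: "real \<Rightarrow> real fps \<Rightarrow> nat \<Rightarrow> nat \<Rightarrow> real" where
  "exp_power_coeff a u n i = fact n / fact i * fps_nth (fps_exp a * u ^ i) n"

lemma exp_power_coeff_eq_0:
  assumes "fps_nth u 0 = 0" "n < i"
  shows "exp_power_coeff a u n i = 0"
  using assms by (simp add: exp_power_coeff_def fps_mult_power_nth_eq_0)

lemma exp_power_coeff_0:
  assumes "fps_nth u 0 = 0"
  shows "exp_power_coeff a u 0 i = (if i = 0 then 1 else 0)"
  using assms exp_power_coeff_eq_0[of u 0 i] by (auto simp: exp_power_coeff_def)

text \<open>By the product rule and the equation for \<open>u\<close>, the derivative of exp(a t)
  u^i is (a + a1 i) exp(a t) u^i + i exp(a t) u^(i-1). Now take n!/i! times the coefficient of t^n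
  and use i/i! = 1/(i-1)!.\<close>

lemma exp_power_coeff_Suc:
  assumes "fps_deriv u = 1 + fps_const a1 * u"
  shows "exp_power_coeff a u (Suc n) i = (a + a1 * real i) * exp_power_coeff a u n i
    + (if i = 0 then 0 else exp_power_coeff a u n (i - 1))"
proof -
  have "fact (Suc n) * fps_nth (fps_exp a * u ^ i) (Suc n) =
      fact n * fps_nth (fps_deriv (fps_exp a * u ^ i)) n"
    unfolding fps_deriv_nth by (simp add: algebra_simps)
  then have 1: "exp_power_coeff a u (Suc n) i =
      fact n / fact i * fps_nth (fps_deriv (fps_exp a * u ^ i)) n"
    by (simp add: exp_power_coeff_def)
  show ?thesis
  proof (cases i)
    case 0
    then show ?thesis using 1 by (simp add: exp_power_coeff_def)
  next
    case (Suc m)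
    have "fps_deriv (u ^ i) = fps_const (real i) * (1 + fps_const a1 * u) * u ^ m"
      unfolding fps_deriv_power assms using Suc by simp
    then have "fps_deriv (fps_exp a * u ^ i) =
        fps_const (a + a1 * real i) * (fps_exp a * u ^ i) + fps_const (real i) * (fps_exp a * u ^ m)"
      unfolding fps_deriv_mult fps_exp_deriv using Suc
      by (simp add: algebra_simps flip: fps_const_add fps_const_mult)
    then have "fps_nth (fps_deriv (fps_exp a * u ^ i)) n =
        (a + a1 * real i) * fps_nth (fps_exp a * u ^ i) n + real i * fps_nth (fps_exp a * u ^ m) n"
      by simp
    with 1 have "exp_power_coeff a u (Suc n) i =
        (a + a1 * real i) * (fact n / fact i * fps_nth (fps_exp a * u ^ i) n)
        + fact n * (real i / fact i) * fps_nth (fps_exp a * u ^ m) n"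
      by (simp add: algebra_simps add_divide_distrib)
    moreover have "real i / fact i = 1 / fact m"
      using Suc by (simp del: of_nat_Suc)
    ultimately show ?thesis
      using Suc by (simp add: exp_power_coeff_def)
  qed
qed

lemma tri_eq_sum:
  assumes u: "fps_nth u 0 = 0" "fps_deriv u = 1 + fps_const a1 * u"
  shows "tri lam a1 a2 b1 b2 n k =
    (\<Sum>i\<le>n. (\<Prod>j=1..i. b2 + b1 * real j) * exp_power_coeff a2 u n i
      * (real (i choose k) * lam ^ (i - k)))"
proof (induction n arbitrary: k)
  case 0
  then show ?case by (simp add: exp_power_coeff_0 u)
next
  case (Suc n)
  define P where "P = (\<lambda>i. \<Prod>j=1..i. b2 + b1 * real j)"
  define w where "w = exp_power_coeff a2 u"
  define g where "g = (\<lambda>i k. real (i choose k) * lam ^ (i - k))"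
  have IH: "tri lam a1 a2 b1 b2 n k = (\<Sum>i\<le>n. P i * w n i * g i k)" for k
    unfolding P_def w_def g_def by (rule Suc)
  have P_Suc: "P (Suc i) = P i * (b2 + b1 * real (Suc i))" for i
    by (simp add: P_def)
  \<comment> \<open>Removes the top term \<open>i = Suc n\<close> of the unshifted sum, so that both
    sums below run over \<open>i \<le> n\<close>.\<close>
  have w0: "w n (Suc n) = 0"
    by (simp add: w_def exp_power_coeff_eq_0 u)
  have "(\<Sum>i\<le>Suc n. P i * w (Suc n) i * g i k) =
      (\<Sum>i\<le>Suc n. P i * w n i * ((a2 + a1 * real i) * g i k))
      + (\<Sum>i\<le>Suc n. if i = 0 then 0 else P i * w n (i - 1) * g i k)"
    unfolding sum.distrib[symmetric] w_def exp_power_coeff_Suc[OF u(2)]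
    by (intro sum.cong) (auto simp: algebra_simps)
  also have "(\<Sum>i\<le>Suc n. P i * w n i * ((a2 + a1 * real i) * g i k)) =
      (\<Sum>i\<le>n. P i * w n i * ((a2 + a1 * real i) * g i k))"
    by (simp add: w0)
  \<comment> \<open>Replacing \<open>i\<close> by \<open>i + 1\<close> turns the product
    \<open>P\<close> into \<open>P i\<close> times the factor that
    \<open>binomial_shift_identity\<close> expects.\<close>
  also have "(\<Sum>i\<le>Suc n. if i = 0 then 0 else P i * w n (i - 1) * g i k) =
      (\<Sum>i\<le>n. P i * w n i * ((b2 + b1 * real (Suc i)) * g (Suc i) k))"
    by (subst sum.atMost_Suc_shift) (simp add: P_Suc ac_simps)
  also have "(\<Sum>i\<le>n. P i * w n i * ((a2 + a1 * real i) * g i k)) + \<dots> =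
      (\<Sum>i\<le>n. P i * w n i * ((a2 + a1 * real i) * g i k + (b2 + b1 * real (Suc i)) * g (Suc i) k))"
    by (simp add: sum.distrib distrib_left)
  also have "\<dots> = (\<Sum>i\<le>n. P i * w n i *
      ((if k = 0 then 0 else (b1 * real k + b2) * g i (k - 1))
      + ((2 * lam * b1 + a1) * real k + a2 + lam * (b1 + b2)) * g i k
      + lam * (a1 + lam * b1) * (real k + 1) * g i (k + 1)))"
    unfolding g_def binomial_shift_identity ..
  also have "\<dots> =
      (if k = 0 then 0 else (b1 * real k + b2) * tri lam a1 a2 b1 b2 n (k - 1))
      + ((2 * lam * b1 + a1) * real k + a2 + lam * (b1 + b2)) * tri lam a1 a2 b1 b2 n k
      + lam * (a1 + lam * b1) * (real k + 1) * tri lam a1 a2 b1 b2 n (k + 1)"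
    unfolding IH by (simp add: sum_distrib_left sum.distrib distrib_left ac_simps)
  finally have rec: "(\<Sum>i\<le>Suc n. P i * w (Suc n) i * g i k) = \<dots>" .
  have "tri lam a1 a2 b1 b2 (Suc n) k = (\<Sum>i\<le>Suc n. P i * w (Suc n) i * g i k)"
  proof (cases "k \<le> Suc n")
    case True
    then show ?thesis
      by (simp only: rec tri.simps if_True)
  next
    \<comment> \<open>Above the diagonal the triangle is zero by definition, and every
      \<open>i choose k\<close> in the sum is zero too.\<close>
    case False
    then show ?thesis
      by (simp add: g_def binomial_eq_0)
  qed
  then show ?case
    by (simp only: P_def w_def g_def)
qed

text \<open>Terms with \<open>i > n\<close> vanish since t^i divides u^i, those with
  \<open>i < k\<close> since \<open>i choose k = 0\<close>. Hence \<open>{k..}\<close> and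
  \<open>{..n}\<close> give the same sum.\<close>

lemma tri_has_sum:
  assumes u: "fps_nth u 0 = 0" "fps_deriv u = 1 + fps_const a1 * u"
  shows "((\<lambda>i. (\<Prod>j=1..i. b2 + b1 * real j) * exp_power_coeff a2 u n i
      * (real (i choose k) * lam ^ (i - k))) has_sum tri lam a1 a2 b1 b2 n k) {k..}"
  unfolding tri_eq_sum[OF u]
  by (subst has_sum_cong_neutral[where T = "{..n}"])
     (auto simp: exp_power_coeff_eq_0 u intro: has_sum_finite)

lemma tri_poly_eq_sum:
  assumes u: "fps_nth u 0 = 0" "fps_deriv u = 1 + fps_const a1 * u"
  shows "tri_poly lam a1 a2 b1 b2 n =
    (\<Sum>i\<le>n. smult ((\<Prod>j=1..i. b2 + b1 * real j) * exp_power_coeff a2 u n i) ([:lam, 1:] ^ i))"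
proof (rule poly_eqI)
  fix k
  have "tri lam a1 a2 b1 b2 n k = 0" if "k > n"
    using that by (cases n) auto
  then have "coeff (tri_poly lam a1 a2 b1 b2 n) k = tri lam a1 a2 b1 b2 n k"
    by (auto simp: tri_poly_def coeff_sum)
  then show "coeff (tri_poly lam a1 a2 b1 b2 n) k = coeff (\<Sum>i\<le>n.
      smult ((\<Prod>j=1..i. b2 + b1 * real j) * exp_power_coeff a2 u n i) ([:lam, 1:] ^ i)) k"
    by (simp add: tri_eq_sum[OF u] coeff_sum coeff_monic_linear_power)
qed

section \<open>Exponential generating functions\<close>

text \<open>The scalar \<open>c\<close> lets one statement serve both shapes: the binomial series
  with \<open>c = - b1\<close>, and the exponential series with \<open>c = b2\<close> when
  \<open>b1 = 0\<close>.\<close>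

lemma tri_egf_eq_compose:
  assumes u: "fps_nth u 0 = 0" "fps_deriv u = 1 + fps_const a1 * u"
    and f: "\<And>i. fps_nth f i * c ^ i = (\<Prod>j=1..i. b2 + b1 * real j) / fact i"
  shows "tri_egf lam a1 a2 b1 b2 =
    fps_lift (fps_exp a2) * fps_compose (fps_lift f) (fps_const (smult c [:lam, 1:]) * fps_lift u)"
proof (rule fps_ext)
  fix n
  have "(\<Prod>j=1..i. b2 + b1 * real j) * exp_power_coeff a2 u n i / fact n =
      fps_nth f i * fps_nth (fps_exp a2 * u ^ i) n * c ^ i" for i
  proof -
    have "fps_nth f i * fps_nth (fps_exp a2 * u ^ i) n * c ^ i =
        (\<Prod>j=1..i. b2 + b1 * real j) / fact i * fps_nth (fps_exp a2 * u ^ i) n"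
      using f[of i] by (metis mult.assoc mult.commute)
    then show ?thesis
      by (simp add: exp_power_coeff_def)
  qed
  then show "fps_nth (tri_egf lam a1 a2 b1 b2) n = fps_nth (fps_lift (fps_exp a2) *
      fps_compose (fps_lift f) (fps_const (smult c [:lam, 1:]) * fps_lift u)) n"
    by (simp add: tri_egf_def tri_poly_eq_sum[OF u] fps_lift_mult_compose_nth[OF u(1)]
        smult_sum_right smult_power del: smult_pCons)
qed

text \<open>Giving each factor of the falling factorial one factor -b1 yields (-(1 + b2/b1) - j)
  (-b1) = b2 + b1 (j + 1).\<close>

lemma gbinomial_mult_power_eq_prod:
  fixes b1 b2 :: real
  assumes "b1 \<noteq> 0"
  shows "((- (1 + b2 / b1)) gchoose i) * (- b1) ^ i = (\<Prod>j=1..i. b2 + b1 * real j) / fact i"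
proof -
  have "(\<Prod>j=0..<i. - (1 + b2 / b1) - real j) * (- b1) ^ i =
      (\<Prod>j=0..<i. (- (1 + b2 / b1) - real j) * (- b1))"
    unfolding prod.distrib by simp
  also have "\<dots> = (\<Prod>j=0..<i. b2 + b1 * real (Suc j))"
    using assms by (intro prod.cong) (auto simp: field_simps)
  also have "\<dots> = (\<Prod>j=1..i. b2 + b1 * real j)"
    by (simp add: prod.atLeast1_atMost_eq atLeast0LessThan)
  finally show ?thesis
    by (simp add: gbinomial_prod_rev)
qed

lemma tri_egf_binomial:
  assumes "fps_nth u 0 = 0" "fps_deriv u = 1 + fps_const a1 * u" "b1 \<noteq> 0"
  shows "tri_egf lam a1 a2 b1 b2 = fps_lift (fps_exp a2) *
    fps_rpow (1 + fps_const (smult (- b1) [:lam, 1:]) * fps_lift u) (- (1 + b2 / b1))"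
  unfolding fps_rpow_def add_diff_cancel_left'
  using assms gbinomial_mult_power_eq_prod[of b1 b2]
  by (intro tri_egf_eq_compose) auto

section \<open>Closed forms of the coefficients\<close>

lemma exp_power_coeff_exp:
  assumes "a1 \<noteq> 0"
  shows "exp_power_coeff a (fps_const (1 / a1) * (fps_exp a1 - 1)) n i =
    1 / a1 ^ i * (1 / fact i) *
      (\<Sum>j\<le>i. real (i choose j) * (-1) ^ (i - j) * (a + a1 * real j) ^ n)"
proof -
  have "(fps_exp a1 - 1 :: real fps) ^ i =
      (\<Sum>j\<le>i. fps_const (real (i choose j) * (-1) ^ (i - j)) * fps_exp (real j * a1))"
    unfolding diff_conv_add_uminus binomial_ring
    by (intro sum.cong)
      (simp_all add: fps_exp_power_mult ac_simps fps_of_nat flip: fps_const_mult fps_const_power fps_const_neg)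
  \<comment> \<open>The binomial theorem has left a combination of exponentials. The coefficient of
    t^n in exp(c t) is c^n/n!, and this n! cancels the one in
    \<open>exp_power_coeff\<close>.\<close>
  then have "fps_exp a * (fps_const (1 / a1) * (fps_exp a1 - 1)) ^ i =
      fps_const (1 / a1 ^ i) * (\<Sum>j\<le>i. fps_const (real (i choose j) * (-1) ^ (i - j))
        * fps_exp (a + a1 * real j))"
    by (simp add: power_mult_distrib fps_const_power sum_distrib_left fps_exp_add_mult
        power_divide ac_simps)
  then show ?thesis
    by (simp add: exp_power_coeff_def fps_sum_nth sum_distrib_left ac_simps)
qed

lemma exp_power_coeff_X:
  "exp_power_coeff a fps_X n i = real (n choose i) * a ^ (n - i)"
  by (auto simp: exp_power_coeff_def fps_X_power_mult_right_nth binomial_fact)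

theorem theorem4p1:
  fixes lam a1 a2 b1 b2 :: real
  assumes "a1\<^sup>2 + b1\<^sup>2 \<noteq> 0"
  shows
    "(a1 * b1 \<noteq> 0 \<longrightarrow>
        tri_egf lam a1 a2 b1 b2 =
          fps_lift (fps_exp a2) *
          fps_rpow (1 + fps_const (smult (b1 / a1) [:lam, 1:]) * (1 - fps_lift (fps_exp a1)))
            (- (1 + b2 / b1)))
     \<and> (a1 = 0 \<and> b1 \<noteq> 0 \<longrightarrow>
        tri_egf lam a1 a2 b1 b2 =
          fps_lift (fps_exp a2) *
          fps_rpow (1 - fps_const (smult b1 [:lam, 1:]) * fps_X) (- (1 + b2 / b1)))
     \<and> (a1 \<noteq> 0 \<and> b1 = 0 \<longrightarrow>
        tri_egf lam a1 a2 b1 b2 =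
          fps_exp_of (fps_const [:a2:] * fps_X
            + fps_const (smult (b2 / a1) [:lam, 1:]) * (fps_lift (fps_exp a1) - 1)))
     \<and> (a1 \<noteq> 0 \<longrightarrow> (\<forall>n k.
        ((\<lambda>i. (\<Prod>j=1..i. b2 + b1 * real j) / a1 ^ i * real (i choose k) * lam ^ (i - k)
               * (1 / fact i)
               * (\<Sum>j\<le>i. real (i choose j) * (-1) ^ (i - j) * (a2 + a1 * real j) ^ n))
          has_sum tri lam a1 a2 b1 b2 n k) {k..}))
     \<and> (a1 = 0 \<longrightarrow> (\<forall>n k.
        ((\<lambda>i. (\<Prod>j=1..i. b2 + b1 * real j) * real (n choose i) * real (i choose k)
               * lam ^ (i - k) * a2 ^ (n - i))
          has_sum tri lam a1 a2 b1 b2 n k) {k..}))"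
proof -
  define u where "u = fps_const (1 / a1) * (fps_exp a1 - 1)"
  have u: "fps_nth u 0 = 0" "fps_deriv u = 1 + fps_const a1 * u" if "a1 \<noteq> 0"
    using that by (auto simp: u_def fps_eq_iff)
  \<comment> \<open>For \<open>a1 = 0\<close> division by zero makes the series \<open>u\<close>
    above zero, so \<open>fps_X\<close> takes its place.\<close>
  have X: "fps_nth (fps_X :: real fps) 0 = 0"
      "fps_deriv (fps_X :: real fps) = 1 + fps_const a1 * fps_X" if "a1 = 0"
    using that by auto
  have lift_u: "fps_const (smult c p) * fps_lift u =
      fps_const (smult (c / a1) p) * (fps_lift (fps_exp a1) - 1)" for c p
    unfolding u_def fps_lift_mult fps_lift_diff fps_lift_1 fps_lift_const
    by (simp add: mult.assoc[symmetric])
  have 1: "tri_egf lam a1 a2 b1 b2 = fps_lift (fps_exp a2) *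
      fps_rpow (1 + fps_const (smult (b1 / a1) [:lam, 1:]) * (1 - fps_lift (fps_exp a1)))
        (- (1 + b2 / b1))" if "a1 * b1 \<noteq> 0"
  proof -
    have "fps_const (smult (- b1) [:lam, 1:]) * fps_lift u =
        fps_const (smult (b1 / a1) [:lam, 1:]) * (1 - fps_lift (fps_exp a1))"
      unfolding lift_u by (simp add: fps_eq_iff algebra_simps)
    then show ?thesis
      using tri_egf_binomial[OF u, of b1 lam a2 b2] that by simp
  qed
  have 2: "tri_egf lam a1 a2 b1 b2 = fps_lift (fps_exp a2) *
      fps_rpow (1 - fps_const (smult b1 [:lam, 1:]) * fps_X) (- (1 + b2 / b1))"
    if "a1 = 0" "b1 \<noteq> 0"
  proof -
    have "1 + fps_const (smult (- b1) [:lam, 1:]) * fps_lift fps_X =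
        1 - fps_const (smult b1 [:lam, 1:]) * fps_X"
      by (simp add: fps_lift_X fps_eq_iff)
    then show ?thesis
      using tri_egf_binomial[OF X, of b1 lam a2 b2] that by simp
  qed
  have 3: "tri_egf lam a1 a2 b1 b2 = fps_exp_of (fps_const [:a2:] * fps_X
      + fps_const (smult (b2 / a1) [:lam, 1:]) * (fps_lift (fps_exp a1) - 1))"
    if "a1 \<noteq> 0" "b1 = 0"
  proof -
    have "tri_egf lam a1 a2 b1 b2 =
        fps_lift (fps_exp a2) * fps_exp_of (fps_const (smult b2 [:lam, 1:]) * fps_lift u)"
      unfolding fps_exp_of_def using u that by (intro tri_egf_eq_compose) auto
    also have "\<dots> = fps_exp_of (fps_const [:a2:] * fps_X
        + fps_const (smult b2 [:lam, 1:]) * fps_lift u)"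
      using u that by (subst fps_exp_of_add_linear) auto
    finally show ?thesis
      by (simp only: lift_u)
  qed
  have 4: "((\<lambda>i. (\<Prod>j=1..i. b2 + b1 * real j) / a1 ^ i * real (i choose k) * lam ^ (i - k)
               * (1 / fact i)
               * (\<Sum>j\<le>i. real (i choose j) * (-1) ^ (i - j) * (a2 + a1 * real j) ^ n))
          has_sum tri lam a1 a2 b1 b2 n k) {k..}" if "a1 \<noteq> 0" for n k
    using tri_has_sum[OF u[OF that], of b2 b1 a2 n k lam]
    unfolding u_def exp_power_coeff_exp[OF that] by (simp add: mult_ac)
  have 5: "((\<lambda>i. (\<Prod>j=1..i. b2 + b1 * real j) * real (n choose i) * real (i choose k)
               * lam ^ (i - k) * a2 ^ (n - i))
          has_sum tri lam a1 a2 b1 b2 n k) {k..}" if "a1 = 0" for n k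
    using tri_has_sum[OF X[OF that], of b2 b1 a2 n k lam]
    unfolding exp_power_coeff_X by (simp add: mult_ac)
  show ?thesis
    using 1 2 3 4 5 by blast
qed

end
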